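(* For positive integers $k\le n$, $\theta_k(\ell_2,\ell_2)=\left(\frac{n}{k}\right)^{k/2}$, i.e. $\max\{\|C_k(B)\|_2 : B\in\mathbb{C}^{n\times n},\ \|\mathrm{col}_i(B)\|_2=1,\ i=1,\ldots,n\}=(n/k)^{k/2}$. Furthermore, if $A\in\mathbb{C}^{n\times n}$ is nonsingular and $k<n$, then $$\|C_k(A)\|_2 < \left(\frac{n}{k}\right)^{k/2}\max_{\alpha\subseteq\{1,\ldots,n\},\ |\alpha|=k}\ \prod_{i\in\alpha}\|\mathrm{col}_i(A)\|_2.$$
   Context: $C_k(B)$ is the $k$th compound of $B$: the $\binom nk\times\binom nk$ matrix of all $k\times k$ minors $\det B(\alpha|\beta)$, indexed by $k$-subsets $\alpha,\beta$ of $\{1,\ldots,n\}$. $\mathrm{col}_i(B)$ is the $i$th column of $B$. For vectors $\|\cdot\|_2$ is the Euclidean norm; for matrices it is the induced operator (spectral) norm. $\theta_k(\mu,\nu)$ denotes $\max\{\mu(C_k(B)): \nu(\mathrm{col}_i(B))=1\ \forall i\}$. *)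

theory Defs
  imports Complex_Main "Jordan_Normal_Form.Determinant" "Jordan_Normal_Form.DL_Submatrix"
begin

definition vec_l2 :: "complex vec \<Rightarrow> real" where
  "vec_l2 v = sqrt (\<Sum>i<dim_vec v. (cmod (v $ i))\<^sup>2)"

definition spec_norm :: "complex mat \<Rightarrow> real" where
  "spec_norm M = Sup {vec_l2 (M *\<^sub>v x) | x. x \<in> carrier_vec (dim_col M) \<and> vec_l2 x = 1}"

definition ksubsets :: "nat \<Rightarrow> nat \<Rightarrow> nat list list" where
  "ksubsets n k = filter (\<lambda>l. length l = k) (subseqs [0..<n])"

definition compound :: "nat \<Rightarrow> complex mat \<Rightarrow> complex mat" where
  "compound k B = (let L = ksubsets (dim_row B) k in
     mat (length L) (length L) (\<lambda>(i,j). det (submatrix B (set (L ! i)) (set (L ! j)))))"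

end

theory Submission
  imports Defs "Jordan_Normal_Form.Spectral_Radius"
begin

text \<open>Diagonalise the Gram matrix, \<open>B\<^sup>*B = U diag(d) U\<^sup>*\<close>. By Cauchy--Binet the compound
  is multiplicative, so \<open>C\<^sub>k(B)\<^sup>* C\<^sub>k(B)\<close> is unitarily similar to the diagonal matrix of the products
  of \<open>d\<close> over \<open>k\<close>-subsets. Unit columns give trace \<open>n\<close>, and AM-GM bounds each
  product by \<open>(n/k)\<^sup>k\<close>, strictly if \<open>k < n\<close> and all \<open>d\<^sub>i\<close> are positive. Equality occurs when
  \<open>B\<close> is a tight frame for a \<open>k\<close>-dimensional space. A nonsingular \<open>A\<close> factors as \<open>B D\<close>
  with unit columns in \<open>B\<close> and the column norms of \<open>A\<close> on the diagonal of \<open>D\<close>.\<close>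

section \<open>The Cauchy--Binet formula and compound matrices\<close>

lemma ksubsets_memD:
  assumes "\<alpha> \<in> set (ksubsets n k)"
  shows "length \<alpha> = k" "distinct \<alpha>" "sorted \<alpha>" "set \<alpha> \<subseteq> {0..<n}" "card (set \<alpha>) = k"
proof -
  have m: "\<alpha> \<in> set (subseqs [0..<n])" and l: "length \<alpha> = k"
    using assms by (auto simp: ksubsets_def)
  show "length \<alpha> = k" by (fact l)
  show d: "distinct \<alpha>" using subseqs_distinctD[OF m] by simp
  have "sorted xs \<Longrightarrow> ys \<in> set (subseqs xs) \<Longrightarrow> set ys \<subseteq> set xs \<and> sorted ys" for xs ys :: "nat list"
    by (induction xs arbitrary: ys) (fastforce simp: Let_def)+
  from this[of "[0..<n]", OF _ m] show "sorted \<alpha>" "set \<alpha> \<subseteq> {0..<n}" by auto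
  show "card (set \<alpha>) = k" using distinct_card[OF d] l by simp
qed

lemma ksubsets_nth_less:
  assumes "\<alpha> \<in> set (ksubsets n k)" "i < k"
  shows "\<alpha> ! i < n"
  using ksubsets_memD(1,4)[OF assms(1)] nth_mem[of i \<alpha>] assms(2)
  by (metis atLeastLessThan_iff subsetD)

lemma distinct_ksubsets: "distinct (ksubsets n k)"
  unfolding ksubsets_def
  using distinct_set_subseqs[of "[0..<n]"] by (auto simp: distinct_map)

lemma sorted_list_of_set_ksubsets:
  assumes "S \<subseteq> {0..<n}" "card S = k"
  shows "sorted_list_of_set S \<in> set (ksubsets n k)"
proof -
  have fin: "finite S" using assms finite_subset by blast
  obtain \<alpha> where \<alpha>: "\<alpha> \<in> set (subseqs [0..<n])" "S = set \<alpha>"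
    using subset_subseqs[of S "[0..<n]"] assms by auto
  have "length \<alpha> = k" using \<alpha> assms subseqs_distinctD[OF \<alpha>(1)] by (simp add: distinct_card)
  hence mem: "\<alpha> \<in> set (ksubsets n k)" using \<alpha> by (simp add: ksubsets_def)
  note * = ksubsets_memD[OF mem]
  have "sorted_list_of_set S = \<alpha>"
    using sorted_list_of_set.idem_if_sorted_distinct[of \<alpha>] * \<alpha> by simp
  thus ?thesis using mem by simp
qed

lemma ksubsets_eqI:
  assumes "\<alpha> \<in> set (ksubsets n k)" "\<beta> \<in> set (ksubsets n k)" "set \<alpha> = set \<beta>"
  shows "\<alpha> = \<beta>"
  using ksubsets_memD[OF assms(1)] ksubsets_memD[OF assms(2)] assms(3) sorted_distinct_set_unique by blast

lemma nth_ksubsets_bij: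
  assumes "\<gamma> \<in> set (ksubsets n k)"
  shows "bij_betw ((!) \<gamma>) {0..<k} (set \<gamma>)"
  using ksubsets_memD[OF assms] bij_betw_nth[of \<gamma> "{0..<k}" "set \<gamma>"] by (auto simp: atLeast0LessThan)

text \<open>\<open>submatrix\<close> selects elements of a set by rank. An entry of a strictly
  increasing list has as many smaller entries as its position says, so rank and position agree and
  minors can be handled by list indexing.\<close>

lemma pick_set_sorted:
  fixes \<alpha> :: "nat list"
  assumes "sorted \<alpha>" "distinct \<alpha>" "i < length \<alpha>"
  shows "pick (set \<alpha>) i = \<alpha> ! i"
proof -
  have "{a \<in> set \<alpha>. a < \<alpha> ! i} = (!) \<alpha> ` {..<i}"
  proof (intro equalityI subsetI)
    fix a assume "a \<in> {a \<in> set \<alpha>. a < \<alpha> ! i}"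
    then obtain j where j: "j < length \<alpha>" "a = \<alpha> ! j" "\<alpha> ! j < \<alpha> ! i" by (auto simp: in_set_conv_nth)
    have "j < i" using sorted_nth_mono[OF assms(1), of i j] j assms(3) by (meson linorder_not_le)
    thus "a \<in> (!) \<alpha> ` {..<i}" using j by auto
  next
    fix a assume "a \<in> (!) \<alpha> ` {..<i}"
    then obtain j where j: "j < i" "a = \<alpha> ! j" by auto
    have "\<alpha> ! j \<le> \<alpha> ! i" using sorted_nth_mono[OF assms(1), of j i] j assms by auto
    moreover have "\<alpha> ! j \<noteq> \<alpha> ! i" using nth_eq_iff_index_eq[OF assms(2), of j i] j assms by auto
    ultimately show "a \<in> {a \<in> set \<alpha>. a < \<alpha> ! i}" using j assms by auto
  qed
  moreover have "inj_on ((!) \<alpha>) {..<i}" using assms by (auto simp: inj_on_def nth_eq_iff_index_eq)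
  ultimately have "card {a \<in> set \<alpha>. a < \<alpha> ! i} = i" by (simp add: card_image)
  thus ?thesis using pick_card_in_set[of "\<alpha> ! i" "set \<alpha>"] assms by simp
qed

text \<open>Indexing by lists instead of by \<open>pick\<close> turns a permutation of rows or
  columns into a plain reindexing.\<close>

definition minor_mat :: "nat \<Rightarrow> 'a mat \<Rightarrow> nat list \<Rightarrow> nat list \<Rightarrow> 'a mat" where
  "minor_mat k A \<alpha> \<beta> = mat k k (\<lambda>(a, b). A $$ (\<alpha> ! a, \<beta> ! b))"

lemma minor_mat_carrier [simp]: "minor_mat k A \<alpha> \<beta> \<in> carrier_mat k k"
  by (simp add: minor_mat_def)

lemma submatrix_eq_minor_mat:
  assumes "A \<in> carrier_mat n n" "\<alpha> \<in> set (ksubsets n k)" "\<beta> \<in> set (ksubsets n k)"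
  shows "submatrix A (set \<alpha>) (set \<beta>) = minor_mat k A \<alpha> \<beta>"
proof -
  note a = ksubsets_memD[OF assms(2)] and b = ksubsets_memD[OF assms(3)]
  have "{i. i < n \<and> i \<in> set \<alpha>} = set \<alpha>" "{i. i < n \<and> i \<in> set \<beta>} = set \<beta>" using a b by auto
  thus ?thesis using assms(1) a b
    by (auto simp: submatrix_def minor_mat_def pick_set_sorted intro!: cong_mat)
qed

lemma compound_carrier [simp]:
  assumes "A \<in> carrier_mat n n"
  shows "compound k A \<in> carrier_mat (length (ksubsets n k)) (length (ksubsets n k))"
  using assms by (simp add: compound_def Let_def)

lemma compound_index:
  assumes "A \<in> carrier_mat n n" "i < length (ksubsets n k)" "j < length (ksubsets n k)"
  shows "compound k A $$ (i, j) = det (minor_mat k A (ksubsets n k ! i) (ksubsets n k ! j))"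
  using assms submatrix_eq_minor_mat[OF assms(1) nth_mem[OF assms(2)] nth_mem[OF assms(3)]]
  by (simp add: compound_def Let_def)

text \<open>An injective map from \<open>{0..<k}\<close> to \<open>{0..<n}\<close> is the increasing enumeration \<open>\<gamma>\<close> of its
  image precomposed with a permutation.\<close>

lemma bij_betw_ksubsets_permutes:
  "bij_betw (\<lambda>(\<gamma>, p) i. if i < k then \<gamma> ! p i else i)
     (set (ksubsets n k) \<times> {p. p permutes {0..<k}})
     {f. (\<forall>i\<in>{0..<k}. f i \<in> {0..<n}) \<and> (\<forall>i. i \<notin> {0..<k} \<longrightarrow> f i = i) \<and> inj_on f {0..<k}}"
  (is "bij_betw ?h ?D ?F")
proof (rule bij_betw_imageI)
  \<comment> \<open>The image of the composite map depends on \<open>\<gamma>\<close> alone;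
    injectivity therefore recovers \<open>\<gamma>\<close> first and \<open>p\<close>
    afterwards.\<close>
  have img: "?h (\<gamma>, p) ` {0..<k} = set \<gamma>" if "\<gamma> \<in> set (ksubsets n k)" "p permutes {0..<k}" for \<gamma> p
  proof -
    have "?h (\<gamma>, p) ` {0..<k} = (!) \<gamma> ` p ` {0..<k}" by (auto simp: image_iff)
    also have "\<dots> = set \<gamma>"
      using nth_ksubsets_bij[OF that(1)] permutes_image[OF that(2)] by (simp add: bij_betw_def)
    finally show ?thesis .
  qed
  show "inj_on ?h ?D"
  proof (rule inj_onI, clarify)
    fix \<gamma> p \<delta> q
    assume \<gamma>: "\<gamma> \<in> set (ksubsets n k)" and p: "p permutes {0..<k}"
      and \<delta>: "\<delta> \<in> set (ksubsets n k)" and q: "q permutes {0..<k}"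
      and eq: "(\<lambda>i. if i < k then \<gamma> ! p i else i) = (\<lambda>i. if i < k then \<delta> ! q i else i)"
    have "set \<gamma> = set \<delta>" using img[OF \<gamma> p] img[OF \<delta> q] eq by simp
    hence gd: "\<gamma> = \<delta>" by (rule ksubsets_eqI[OF \<gamma> \<delta>])
    have "p i = q i" for i
    proof (cases "i < k")
      case True
      have "p i < k" "q i < k" using permutes_in_image[OF p, of i] permutes_in_image[OF q, of i] True by auto
      moreover have "\<gamma> ! p i = \<gamma> ! q i" using fun_cong[OF eq, of i] True gd by simp
      ultimately show ?thesis using ksubsets_memD[OF \<gamma>] nth_eq_iff_index_eq by metis
    next
      case False
      thus ?thesis using p q by (simp add: permutes_def)
    qed
    thus "\<gamma> = \<delta> \<and> p = q" using gd by auto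
  qed
  show "?h ` ?D = ?F"
  proof (intro equalityI subsetI)
    fix f assume "f \<in> ?h ` ?D"
    then obtain \<gamma> p where g: "\<gamma> \<in> set (ksubsets n k)" and p: "p permutes {0..<k}" and f: "f = ?h (\<gamma>, p)"
      by auto
    have i: "f ` {0..<k} = set \<gamma>" using img[OF g p] f by simp
    have "inj_on f {0..<k}"
      by (rule eq_card_imp_inj_on) (use i ksubsets_memD[OF g] in auto)
    moreover have "f i \<in> {0..<n}" if "i \<in> {0..<k}" for i
      using i ksubsets_memD[OF g] that by blast
    ultimately show "f \<in> ?F" using f by auto
  next
    fix f assume f: "f \<in> ?F"
    define \<gamma> where "\<gamma> = sorted_list_of_set (f ` {0..<k})"
    have \<gamma>: "\<gamma> \<in> set (ksubsets n k)"
      unfolding \<gamma>_def by (rule sorted_list_of_set_ksubsets) (use f in \<open>auto simp: card_image\<close>)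
    have set: "set \<gamma> = f ` {0..<k}" by (simp add: \<gamma>_def)
    \<comment> \<open>\<open>g\<close> sends an element of the image to its position in
      \<open>\<gamma>\<close>, so \<open>p\<close> below records the rank of
      \<open>f i\<close>.\<close>
    define g where "g = inv_into {0..<k} ((!) \<gamma>)"
    have gb: "bij_betw g (set \<gamma>) {0..<k}" unfolding g_def
      using bij_betw_inv_into[OF nth_ksubsets_bij[OF \<gamma>]] .
    define p where "p = (\<lambda>i. if i < k then g (f i) else i)"
    have "bij_betw f {0..<k} (set \<gamma>)" using f set by (simp add: bij_betw_def)
    from bij_betw_trans[OF this gb] have "bij_betw p {0..<k} {0..<k}"
      by (subst bij_betw_cong[of _ _ "g \<circ> f"]) (auto simp: p_def)
    hence p: "p permutes {0..<k}" by (rule bij_imp_permutes) (auto simp: p_def)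
    have "f i = ?h (\<gamma>, p) i" for i
    proof (cases "i < k")
      case True
      have "\<gamma> ! g (f i) = f i" unfolding g_def
        by (rule f_inv_into_f) (use nth_ksubsets_bij[OF \<gamma>] set True in \<open>auto simp: bij_betw_def\<close>)
      thus ?thesis using True by (simp add: p_def)
    qed (use f in auto)
    hence "f = ?h (\<gamma>, p)" by blast
    thus "f \<in> ?h ` ?D" using \<gamma> p by (intro image_eqI[of _ _ "(\<gamma>, p)"]) auto
  qed
qed

text \<open>Each row of the product is a combination of rows of \<open>B\<close>, so multilinearity
  expands the determinant over all choices \<open>f\<close> of one row of \<open>B\<close> per
  position. A repeated row contributes zero; an injective choice is a subset \<open>\<gamma>\<close>
  with a permutation, and the permutations assemble the minor of \<open>A\<close>.\<close>

lemma Cauchy_Binet: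
  fixes A B :: "'a :: comm_ring_1 mat"
  assumes A: "A \<in> carrier_mat n n" and B: "B \<in> carrier_mat n n"
    and \<alpha>: "\<alpha> \<in> set (ksubsets n k)" and \<beta>: "\<beta> \<in> set (ksubsets n k)"
  shows "det (minor_mat k (A * B) \<alpha> \<beta>) =
    (\<Sum>\<gamma>\<in>set (ksubsets n k). det (minor_mat k A \<alpha> \<gamma>) * det (minor_mat k B \<gamma> \<beta>))"
proof -
  let ?K = "{0..<k}" and ?N = "{0..<n}"
  \<comment> \<open>Functions are the identity off \<open>?K\<close>, which makes the index set
    finite and matches the convention of \<open>permutes\<close>.\<close>
  let ?F = "{f. (\<forall>i\<in>?K. f i \<in> ?N) \<and> (\<forall>i. i \<notin> ?K \<longrightarrow> f i = i)}"
  let ?I = "{f. (\<forall>i\<in>?K. f i \<in> ?N) \<and> (\<forall>i. i \<notin> ?K \<longrightarrow> f i = i) \<and> inj_on f ?K}"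
  have \<alpha>n: "\<alpha> ! i < n" if "i < k" for i
    using ksubsets_nth_less[OF \<alpha> that] .
  have \<beta>n: "\<beta> ! i < n" if "i < k" for i
    using ksubsets_nth_less[OF \<beta> that] .
  \<comment> \<open>\<open>r l\<close> is row \<open>l\<close> of \<open>B\<close> cut down to the
    columns \<open>\<beta>\<close>; \<open>t f\<close> is the term of the choice \<open>f\<close>
    with its coefficients pulled out.\<close>
  define r where "r l = vec k (\<lambda>b. B $$ (l, \<beta> ! b))" for l
  define t where "t f = (\<Prod>i\<in>?K. A $$ (\<alpha> ! i, f i)) * det (mat\<^sub>r k k (\<lambda>i. r (f i)))" for f
  have r [simp]: "r l \<in> carrier_vec k" for l by (simp add: r_def)
  have finF: "finite ?F" by (rule finite_bounded_functions) auto
  have "minor_mat k (A * B) \<alpha> \<beta> =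
      mat\<^sub>r k k (\<lambda>i. finsum_vec TYPE('a) k (\<lambda>l. A $$ (\<alpha> ! i, l) \<cdot>\<^sub>v r l) ?N)"
    (is "?L = ?R")
  proof (rule eq_matI)
    fix i j assume ij: "i < dim_row ?R" "j < dim_col ?R"
    have "?R $$ (i, j) = (\<Sum>l\<in>?N. (A $$ (\<alpha> ! i, l) \<cdot>\<^sub>v r l) $ j)"
      using ij by (auto simp: index_finsum_vec)
    thus "?L $$ (i, j) = ?R $$ (i, j)"
      using ij \<alpha>n[of i] \<beta>n[of j] A B by (auto simp: minor_mat_def r_def scalar_prod_def)
  qed (auto simp: minor_mat_def)
  hence "det (minor_mat k (A * B) \<alpha> \<beta>) = (\<Sum>f\<in>?F. det (mat\<^sub>r k k (\<lambda>i. A $$ (\<alpha> ! i, f i) \<cdot>\<^sub>v r (f i))))"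
    by (simp add: det_linear_rows_sum)
  also have "\<dots> = (\<Sum>f\<in>?F. t f)"
    unfolding t_def by (rule sum.cong[OF refl], rule det_rows_mul) auto
  also have "\<dots> = (\<Sum>f\<in>?I. t f)"
  proof (rule sum.mono_neutral_right[OF finF])
    show "\<forall>f\<in>?F - ?I. t f = 0"
    proof
      fix f assume "f \<in> ?F - ?I"
      then obtain i j where ij: "i < k" "j < k" "i \<noteq> j" "f i = f j" by (auto simp: inj_on_def)
      have "det (mat\<^sub>r k k (\<lambda>i. r (f i))) = 0"
        by (rule det_identical_rows[OF _ ij(3,1,2)]) (use ij in auto)
      thus "t f = 0" by (simp add: t_def)
    qed
  qed auto
  also have "\<dots> = (\<Sum>(\<gamma>, p)\<in>set (ksubsets n k) \<times> {p. p permutes ?K}. t (\<lambda>i. if i < k then \<gamma> ! p i else i))"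
    using sum.reindex_bij_betw[OF bij_betw_ksubsets_permutes[of k n], of t] by (simp add: case_prod_beta)
  also have "\<dots> = (\<Sum>\<gamma>\<in>set (ksubsets n k). \<Sum>p | p permutes ?K. t (\<lambda>i. if i < k then \<gamma> ! p i else i))"
    by (rule sum.cartesian_product[symmetric])
  also have "\<dots> = (\<Sum>\<gamma>\<in>set (ksubsets n k). det (minor_mat k A \<alpha> \<gamma>) * det (minor_mat k B \<gamma> \<beta>))"
  proof (rule sum.cong[OF refl])
    fix \<gamma>
    \<comment> \<open>Sorting the rows of \<open>B\<close> back into increasing order costs
      \<open>signof p\<close>, exactly the sign in the Leibniz formula for the minor of
      \<open>A\<close>.\<close>
    have t: "t (\<lambda>i. if i < k then \<gamma> ! p i else i) =
        signof p * (\<Prod>i\<in>?K. minor_mat k A \<alpha> \<gamma> $$ (i, p i)) * det (minor_mat k B \<gamma> \<beta>)"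
      if p: "p permutes ?K" for p
    proof -
      have pk: "p i < k" if "i < k" for i using permutes_in_image[OF p, of i] that by auto
      have "mat\<^sub>r k k (\<lambda>i. r (if i < k then \<gamma> ! p i else i)) = mat k k (\<lambda>(i, j). minor_mat k B \<gamma> \<beta> $$ (p i, j))"
        by (rule eq_matI) (auto simp: r_def minor_mat_def pk)
      moreover have "(\<Prod>i\<in>?K. A $$ (\<alpha> ! i, if i < k then \<gamma> ! p i else i)) = (\<Prod>i\<in>?K. minor_mat k A \<alpha> \<gamma> $$ (i, p i))"
        by (rule prod.cong) (auto simp: minor_mat_def pk)
      ultimately show ?thesis
        unfolding t_def using det_permute_rows[OF minor_mat_carrier p, of B \<gamma> \<beta>] by (simp add: ac_simps)
    qed
    show "(\<Sum>p | p permutes ?K. t (\<lambda>i. if i < k then \<gamma> ! p i else i)) =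
        det (minor_mat k A \<alpha> \<gamma>) * det (minor_mat k B \<gamma> \<beta>)"
      by (simp add: t det_def'[OF minor_mat_carrier] sum_distrib_right)
  qed
  finally show ?thesis .
qed

text \<open>This is Cauchy-Binet read entrywise; since the list of subsets is distinct, a sum over
  subsets is a sum over matrix indices.\<close>

lemma compound_mult:
  assumes A: "A \<in> carrier_mat n n" and B: "B \<in> carrier_mat n n"
  shows "compound k (A * B) = compound k A * compound k B" (is "?X = ?R")
proof (rule eq_matI)
  let ?L = "ksubsets n k"
  have AB: "A * B \<in> carrier_mat n n" using A B by simp
  note c = compound_carrier[OF A, of k] compound_carrier[OF B, of k] compound_carrier[OF AB, of k]
  fix i j assume "i < dim_row ?R" "j < dim_col ?R"
  hence i: "i < length ?L" and j: "j < length ?L" using c by auto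
  have "compound k (A * B) $$ (i, j) =
      (\<Sum>\<gamma>\<in>set ?L. det (minor_mat k A (?L ! i) \<gamma>) * det (minor_mat k B \<gamma> (?L ! j)))"
    unfolding compound_index[OF AB i j] by (rule Cauchy_Binet[OF A B nth_mem[OF i] nth_mem[OF j]])
  also have "\<dots> = (\<Sum>l<length ?L. det (minor_mat k A (?L ! i) (?L ! l)) * det (minor_mat k B (?L ! l) (?L ! j)))"
    by (rule sum.reindex_bij_betw[symmetric], rule bij_betw_nth) (auto simp: distinct_ksubsets)
  also have "\<dots> = (\<Sum>l<length ?L. compound k A $$ (i, l) * compound k B $$ (l, j))"
    by (rule sum.cong) (auto simp: compound_index[OF A i] compound_index[OF B _ j])
  also have "\<dots> = ?R $$ (i, j)"
    using c i j by (simp add: scalar_prod_def lessThan_atLeast0)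
  finally show "compound k (A * B) $$ (i, j) = ?R $$ (i, j)" .
next
  show "dim_row ?X = dim_row ?R" "dim_col ?X = dim_col ?R"
    using compound_carrier[OF A, of k] compound_carrier[OF B, of k]
      compound_carrier[OF mult_carrier_mat[OF A B], of k] by simp_all
qed

lemma compound_mat_diag:
  "compound k (mat_diag n d) =
   mat_diag (length (ksubsets n k)) (\<lambda>i. \<Prod>a\<in>set (ksubsets n k ! i). d a)" (is "?X = ?R")
proof (rule eq_matI)
  let ?L = "ksubsets n k"
  fix i j assume "i < dim_row ?R" "j < dim_col ?R"
  hence i: "i < length ?L" and j: "j < length ?L" by (auto simp: mat_diag_def)
  note mi = ksubsets_memD[OF nth_mem[OF i]] and mj = ksubsets_memD[OF nth_mem[OF j]]
  have bnd: "?L ! i ! a < n" "?L ! j ! a < n" if "a < k" for a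
    using ksubsets_nth_less[OF nth_mem[OF i] that] ksubsets_nth_less[OF nth_mem[OF j] that] by auto
  let ?M = "minor_mat k (mat_diag n d) (?L ! i) (?L ! j)"
  have "det ?M = (if i = j then \<Prod>a\<in>set (?L ! j). d a else 0)"
  proof (cases "i = j")
    case True
    have M: "?M $$ (a, b) = (if a = b then d (?L ! i ! a) else 0)" if "a < k" "b < k" for a b
      using that True bnd mi by (auto simp: minor_mat_def mat_diag_def nth_eq_iff_index_eq)
    have "upper_triangular ?M" by (auto simp: M carrier_matD[OF minor_mat_carrier])
    hence "det ?M = prod_list (diag_mat ?M)" by (rule det_upper_triangular[OF _ minor_mat_carrier])
    also have "\<dots> = (\<Prod>a<k. ?M $$ (a, a))"
      by (simp add: diag_mat_def carrier_matD[OF minor_mat_carrier] prod.distinct_set_conv_list[symmetric] lessThan_atLeast0)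
    also have "\<dots> = (\<Prod>a<k. d (?L ! i ! a))" by (simp add: M)
    also have "\<dots> = (\<Prod>a\<in>set (?L ! i). d a)"
      by (rule prod.reindex_bij_betw, rule bij_betw_nth) (auto simp: mi)
    finally show ?thesis using True by simp
  next
    case False
    have "?L ! i \<noteq> ?L ! j" using False i j distinct_ksubsets nth_eq_iff_index_eq by blast
    hence "set (?L ! i) \<noteq> set (?L ! j)" using ksubsets_eqI[OF nth_mem[OF i] nth_mem[OF j]] by blast
    \<comment> \<open>Two different sets of equal size: some row index is missing among the column
      indices, and that row of the minor is zero.\<close>
    hence "\<not> set (?L ! i) \<subseteq> set (?L ! j)" using card_subset_eq[of "set (?L ! j)"] mi mj by auto
    then obtain x where "x \<in> set (?L ! i)" "x \<notin> set (?L ! j)" by blast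
    then obtain a where a: "a < k" "?L ! i ! a \<notin> set (?L ! j)" using mi(1) by (metis in_set_conv_nth)
    have z: "?M $$ (a, b) = 0" if "b < k" for b
    proof -
      have "?L ! j ! b \<in> set (?L ! j)" using mj(1) that by simp
      hence "?L ! i ! a \<noteq> ?L ! j ! b" using a by metis
      thus ?thesis using that a(1) bnd by (simp add: minor_mat_def mat_diag_def)
    qed
    have "signof p * (\<Prod>i = 0..<k. ?M $$ (i, p i)) = 0" if p: "p permutes {0..<k}" for p
    proof -
      have "(\<Prod>i = 0..<k. ?M $$ (i, p i)) = 0"
        by (rule prod_zero) (use a z[of "p a"] permutes_in_image[OF p, of a] in auto)
      thus ?thesis by simp
    qed
    hence "(\<Sum>p | p permutes {0..<k}. signof p * (\<Prod>i = 0..<k. ?M $$ (i, p i))) = 0"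
      by (intro sum.neutral) blast
    thus ?thesis unfolding det_def'[OF minor_mat_carrier] using False by simp
  qed
  thus "compound k (mat_diag n d) $$ (i, j) = ?R $$ (i, j)"
    unfolding compound_index[OF mat_diag_dim i j] using i j by (simp add: mat_diag_def)
next
  show "dim_row ?X = dim_row ?R" "dim_col ?X = dim_col ?R"
    by (simp_all add: carrier_matD[OF mat_diag_dim] carrier_matD[OF compound_carrier[OF mat_diag_dim]])
qed

lemma compound_one: "compound k (1\<^sub>m n) = 1\<^sub>m (length (ksubsets n k))"
  using compound_mat_diag[of k n "\<lambda>_. 1"] by simp

section \<open>Adjoints and unitary diagonalisation\<close>

definition adj :: "complex mat \<Rightarrow> complex mat" where
  "adj A = mat (dim_col A) (dim_row A) (\<lambda>(i, j). cnj (A $$ (j, i)))"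

lemma adj_dim [simp]: "dim_row (adj A) = dim_col A" "dim_col (adj A) = dim_row A"
  by (simp_all add: adj_def)

lemma adj_carrier [simp]: "A \<in> carrier_mat nr nc \<Longrightarrow> adj A \<in> carrier_mat nc nr"
  by (simp add: adj_def)

lemma adj_index [simp]: "i < dim_col A \<Longrightarrow> j < dim_row A \<Longrightarrow> adj A $$ (i, j) = cnj (A $$ (j, i))"
  by (simp add: adj_def)

lemma adj_adj [simp]: "adj (adj A) = A"
  by (rule eq_matI) auto

lemma adj_mult:
  assumes "A \<in> carrier_mat nr m" "B \<in> carrier_mat m nc"
  shows "adj (A * B) = adj B * adj A"
  by (rule eq_matI) (use assms in \<open>auto simp: scalar_prod_def mult.commute intro!: sum.cong\<close>)

lemma adj_one [simp]: "adj (1\<^sub>m n) = 1\<^sub>m n"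
  by (rule eq_matI) auto

lemma adj_mat_diag: "adj (mat_diag n d) = mat_diag n (\<lambda>i. cnj (d i))"
  by (rule eq_matI) (auto simp: mat_diag_def)

lemma det_adj:
  assumes "A \<in> carrier_mat n n"
  shows "det (adj A) = cnj (det A)"
proof -
  interpret cnj: comm_ring_hom cnj by unfold_locales auto
  have "adj A = transpose_mat (map_mat cnj A)" by (rule eq_matI) auto
  thus ?thesis using assms det_transpose[of "map_mat cnj A" n] by simp
qed

text \<open>Taking adjoints swaps the row and column sets of a minor and conjugates its value.
  Together with \<open>compound_mult\<close>, the Gram matrix of a compound becomes the compound of
  the Gram matrix.\<close>

lemma compound_adj:
  assumes A: "A \<in> carrier_mat n n"
  shows "compound k (adj A) = adj (compound k A)"
proof -
  note c = compound_carrier[OF A, of k] compound_carrier[OF adj_carrier[OF A], of k]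
  show ?thesis
  proof (rule eq_matI)
    fix i j assume "i < dim_row (adj (compound k A))" "j < dim_col (adj (compound k A))"
    hence i: "i < length (ksubsets n k)" and j: "j < length (ksubsets n k)" using c by auto
    note bi = ksubsets_nth_less[OF nth_mem[OF i]] and bj = ksubsets_nth_less[OF nth_mem[OF j]]
    have "minor_mat k (adj A) (ksubsets n k ! i) (ksubsets n k ! j) =
        adj (minor_mat k A (ksubsets n k ! j) (ksubsets n k ! i))"
      by (rule eq_matI) (use A bi bj in \<open>auto simp: minor_mat_def\<close>)
    thus "compound k (adj A) $$ (i, j) = adj (compound k A) $$ (i, j)"
      using i j c by (simp add: compound_index[OF A] compound_index[OF adj_carrier[OF A]] det_adj[OF minor_mat_carrier])
  qed (use c in auto)
qed

section \<open>Euclidean norms expressed through the Gram matrix\<close>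

lemma vec_l2_nonneg [simp]: "vec_l2 v \<ge> 0"
  by (simp add: vec_l2_def sum_nonneg)

lemma vec_l2_sq: "(vec_l2 v)\<^sup>2 = (\<Sum>i<dim_vec v. (cmod (v $ i))\<^sup>2)"
  by (simp add: vec_l2_def sum_nonneg)

lemma vec_l2_sq_inner: "complex_of_real ((vec_l2 v)\<^sup>2) = v \<bullet>c v"
  by (simp add: vec_l2_sq scalar_prod_def complex_norm_square lessThan_atLeast0 del: of_real_power)

lemma inner_adj:
  assumes "A \<in> carrier_mat nr nc" "x \<in> carrier_vec nc" "y \<in> carrier_vec nr"
  shows "(A *\<^sub>v x) \<bullet>c y = x \<bullet>c (adj A *\<^sub>v y)"
proof -
  have "(A *\<^sub>v x) \<bullet>c y = (\<Sum>i<nr. \<Sum>j<nc. A $$ (i, j) * x $ j * cnj (y $ i))"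
    using assms by (simp add: scalar_prod_def lessThan_atLeast0 sum_distrib_right)
  also have "\<dots> = (\<Sum>j<nc. \<Sum>i<nr. A $$ (i, j) * x $ j * cnj (y $ i))"
    by (rule sum.swap)
  also have "\<dots> = x \<bullet>c (adj A *\<^sub>v y)"
    using assms by (simp add: scalar_prod_def lessThan_atLeast0 sum_distrib_left mult.commute mult.left_commute)
  finally show ?thesis .
qed

lemma vec_l2_mult_sq:
  assumes A: "A \<in> carrier_mat nr nc" and x: "x \<in> carrier_vec nc"
  shows "complex_of_real ((vec_l2 (A *\<^sub>v x))\<^sup>2) = x \<bullet>c ((adj A * A) *\<^sub>v x)"
  unfolding vec_l2_sq_inner
  using assms inner_adj[OF A x, of "A *\<^sub>v x"] by (simp add: assoc_mult_mat_vec[OF adj_carrier[OF A] A x])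

lemma vec_l2_isometry:
  assumes A: "A \<in> carrier_mat nr nc" and x: "x \<in> carrier_vec nc" and U: "adj A * A = 1\<^sub>m nc"
  shows "vec_l2 (A *\<^sub>v x) = vec_l2 x"
proof -
  have "complex_of_real ((vec_l2 (A *\<^sub>v x))\<^sup>2) = complex_of_real ((vec_l2 x)\<^sup>2)"
    using vec_l2_mult_sq[OF A x] vec_l2_sq_inner[of x] x by (simp add: U del: of_real_power)
  hence "(vec_l2 (A *\<^sub>v x))\<^sup>2 = (vec_l2 x)\<^sup>2" by (simp only: of_real_eq_iff)
  thus ?thesis by simp
qed

text \<open>Complete \<open>v\<close> to a basis, orthogonalise and normalise. Only the direction of
  the first column matters for an eigenvector, so the scalar \<open>c\<close> stays
  unspecified.\<close>

lemma unitary_first_column: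
  assumes v: "v \<in> carrier_vec n" and v0: "v \<noteq> 0\<^sub>v n"
  obtains U c where "U \<in> carrier_mat n n" "adj U * U = 1\<^sub>m n" "col U 0 = c \<cdot>\<^sub>v v" "0 < n"
proof -
  interpret cof_vec_space n "TYPE(complex)" .
  have n: "0 < n" using v v0 by (cases n) auto
  define b where "b = basis_completion v"
  define ws where "ws = gram_schmidt n b"
  from basis_completion[OF v v0, folded b_def]
  have dist_b: "distinct b" and indep: "\<not> lin_dep (set b)" and b: "set b \<subseteq> carrier_vec n"
    and hdb: "hd b = v" and len_b: "length b = n" by auto
  from hdb len_b n obtain vs where bv: "b = v # vs" by (cases b) auto
  from gram_schmidt_result[OF b dist_b indep refl, folded ws_def]
  have ws: "set ws \<subseteq> carrier_vec n" "corthogonal ws" "length ws = n" by (auto simp: len_b)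
  \<comment> \<open>Gram-Schmidt keeps the first vector of the list.\<close>
  have ws0: "ws ! 0 = v"
    using gram_schmidt_hd[OF v, of vs, folded bv] ws n unfolding ws_def by (metis hd_conv_nth length_greater_0_conv)
  \<comment> \<open>\<open>corthogonal\<close> gives orthogonal vectors of arbitrary length;
    \<open>r j\<close> is the length to divide by.\<close>
  define r where "r j = complex_of_real (vec_l2 (ws ! j))" for j
  have wsc: "ws ! j \<in> carrier_vec n" if "j < n" for j using ws that by auto
  have r: "r j * r j = ws ! j \<bullet>c ws ! j" for j
    using vec_l2_sq_inner[of "ws ! j"] by (simp add: r_def power2_eq_square)
  have r0: "r j \<noteq> 0" if "j < n" for j
    using r[of j] corthogonalD[OF ws(2), of j j] that ws by auto
  define U where "U = mat n n (\<lambda>(i, j). ws ! j $ i / r j)"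
  have U: "U \<in> carrier_mat n n" by (simp add: U_def)
  have "adj U * U = 1\<^sub>m n"
  proof (rule eq_matI)
    fix i j assume "i < dim_row (1\<^sub>m n :: complex mat)" "j < dim_col (1\<^sub>m n :: complex mat)"
    hence ij: "i < n" "j < n" by auto
    have "(adj U * U) $$ (i, j) = (\<Sum>l<n. cnj (ws ! i $ l / r i) * (ws ! j $ l / r j))"
      using ij U by (simp add: scalar_prod_def lessThan_atLeast0) (simp add: U_def)
    also have "\<dots> = (\<Sum>l<n. ws ! j $ l * cnj (ws ! i $ l)) / (r i * r j)"
      by (simp add: sum_divide_distrib r_def field_simps)
    also have "(\<Sum>l<n. ws ! j $ l * cnj (ws ! i $ l)) = ws ! j \<bullet>c ws ! i"
      using wsc[OF ij(1)] by (simp add: scalar_prod_def lessThan_atLeast0)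
    also have "(ws ! j \<bullet>c ws ! i) / (r i * r j) = 1\<^sub>m n $$ (i, j)"
      using corthogonalD[OF ws(2), of j i] ij ws(3) r[of i] r0[of i] by auto
    finally show "(adj U * U) $$ (i, j) = 1\<^sub>m n $$ (i, j)" .
  qed (use U in auto)
  moreover have "col U 0 = (1 / r 0) \<cdot>\<^sub>v v"
    by (rule eq_vecI) (use n v ws0 in \<open>auto simp: U_def\<close>)
  ultimately show ?thesis using that U n by blast
qed

lemma mat_diag_Suc:
  "mat_diag (Suc m) (case_nat e d) = four_block_mat (mat_diag 1 (\<lambda>_. e)) (0\<^sub>m 1 m) (0\<^sub>m m 1) (mat_diag m d)"
  by (rule eq_matI) (auto simp: mat_diag_def split: nat.splits)

lemma adj_four_block_diag:
  assumes "A \<in> carrier_mat a a" "B \<in> carrier_mat b b"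
  shows "adj (four_block_mat A (0\<^sub>m a b) (0\<^sub>m b a) B) = four_block_mat (adj A) (0\<^sub>m a b) (0\<^sub>m b a) (adj B)"
  by (rule eq_matI) (use assms in auto)

lemma mult_four_block_diag:
  fixes A B A' B' :: "complex mat"
  assumes "A \<in> carrier_mat a a" "B \<in> carrier_mat b b" "A' \<in> carrier_mat a a" "B' \<in> carrier_mat b b"
  shows "four_block_mat A (0\<^sub>m a b) (0\<^sub>m b a) B * four_block_mat A' (0\<^sub>m a b) (0\<^sub>m b a) B' =
    four_block_mat (A * A') (0\<^sub>m a b) (0\<^sub>m b a) (B * B')"
  using assms by (subst mult_four_block_mat[of _ a a _ b _ b _ _ a _ b]) auto

text \<open>Deflation: conjugating by a unitary whose first column is an eigenvector splits off a
  \<open>1\<close> by \<open>1\<close> block, and the induction hypothesis treats the rest.\<close>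

lemma hermitian_unitarily_diagonalizable:
  assumes "A \<in> carrier_mat n n" "adj A = A"
  obtains U d where "U \<in> carrier_mat n n" "adj U * U = 1\<^sub>m n" "adj U * A * U = mat_diag n d"
proof -
  have "\<exists>U d. U \<in> carrier_mat n n \<and> adj U * U = 1\<^sub>m n \<and> adj U * A * U = mat_diag n d"
    using assms
  proof (induction n arbitrary: A)
    case 0
    have "adj (1\<^sub>m 0) * A * 1\<^sub>m 0 = mat_diag 0 (\<lambda>_. 0)" using 0 by (intro eq_matI) (auto simp: mat_diag_def)
    thus ?case by (intro exI[of _ "1\<^sub>m 0"] exI[of _ "\<lambda>_. 0"]) auto
  next
    case (Suc m)
    note A = Suc.prems(1)
    obtain e where "eigenvalue A e" using spectrum_non_empty[OF A] by (auto simp: spectrum_def)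
    then obtain v where v: "v \<in> carrier_vec (Suc m)" "v \<noteq> 0\<^sub>v (Suc m)" "A *\<^sub>v v = e \<cdot>\<^sub>v v"
      using A by (auto simp: eigenvalue_def eigenvector_def)
    obtain U c where U: "U \<in> carrier_mat (Suc m) (Suc m)" "adj U * U = 1\<^sub>m (Suc m)" "col U 0 = c \<cdot>\<^sub>v v"
      using unitary_first_column[OF v(1,2)] by metis
    note aU = adj_carrier[OF U(1)]
    define A' where "A' = adj U * A * U"
    have A': "A' \<in> carrier_mat (Suc m) (Suc m)" 
      unfolding A'_def by (rule mult_carrier_mat[OF mult_carrier_mat[OF aU A] U(1)])
    have hA': "adj A' = A'"
      unfolding A'_def adj_mult[OF mult_carrier_mat[OF aU A] U(1)] adj_mult[OF aU A] Suc.prems(2)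
      using assoc_mult_mat[OF aU A U(1)] by simp
    have "col A' 0 = adj U *\<^sub>v (A *\<^sub>v col U 0)"
      unfolding A'_def assoc_mult_mat[OF aU A U(1)]
    by (simp add: col_mult2[OF aU mult_carrier_mat[OF A U(1)]] col_mult2[OF A U(1)])
    also have "A *\<^sub>v col U 0 = e \<cdot>\<^sub>v col U 0"
      using A v by (auto simp: U(3) mult_mat_vec smult_smult_assoc mult.commute)
    also have "adj U *\<^sub>v (e \<cdot>\<^sub>v col U 0) = e \<cdot>\<^sub>v (adj U *\<^sub>v col U 0)"
      by (rule mult_mat_vec[OF aU]) (use U v(1) in auto)
    also have "adj U *\<^sub>v col U 0 = col (1\<^sub>m (Suc m)) 0" 
      unfolding U(2)[symmetric] by (simp add: col_mult2[OF aU U(1)])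
    finally have c0: "col A' 0 = e \<cdot>\<^sub>v col (1\<^sub>m (Suc m)) 0" .
    have A'0: "A' $$ (i, 0) = (if i = 0 then e else 0)" if "i < Suc m" for i
    proof -
      have "A' $$ (i, 0) = col A' 0 $ i" using A' that by simp
      thus ?thesis unfolding c0 using that by auto
    qed
    \<comment> \<open>The first column is already cleared; hermitian symmetry clears the first row
      as well.\<close>
    have A'0': "A' $$ (0, Suc i) = 0" if "i < m" for i
    proof -
      have "A' $$ (0, Suc i) = cnj (A' $$ (Suc i, 0))"
        using arg_cong[OF hA', of "\<lambda>M. M $$ (0, Suc i)"] A' that by simp
      thus ?thesis using A'0[of "Suc i"] that by simp
    qed
    define B where "B = mat m m (\<lambda>(i, j). A' $$ (Suc i, Suc j))"
    have B: "B \<in> carrier_mat m m" by (simp add: B_def)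
    have "adj B = B"
    proof (rule eq_matI)
      fix i j assume "i < dim_row B" "j < dim_col B"
      hence ij: "i < m" "j < m" using B by auto
      thus "adj B $$ (i, j) = B $$ (i, j)"
        using arg_cong[OF hA', of "\<lambda>M. M $$ (Suc i, Suc j)"] A' by (simp add: B_def)
    qed (use B in auto)
    then obtain V d where V: "V \<in> carrier_mat m m" "adj V * V = 1\<^sub>m m" "adj V * B * V = mat_diag m d"
      using Suc.IH[OF B] by blast
    \<comment> \<open>\<open>W\<close> leaves the eigenvector found fixed and diagonalises the
      remaining block.\<close>
    define W where "W = four_block_mat (1\<^sub>m 1) (0\<^sub>m 1 m) (0\<^sub>m m 1) V"
    have W: "W \<in> carrier_mat (Suc m) (Suc m)"
      using four_block_carrier_mat[OF one_carrier_mat V(1), of 1] by (simp add: W_def)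
    have aW: "adj W = four_block_mat (1\<^sub>m 1) (0\<^sub>m 1 m) (0\<^sub>m m 1) (adj V)"
      unfolding W_def using adj_four_block_diag[OF one_carrier_mat V(1), of 1] by simp
    have A'_block: "A' = four_block_mat (mat_diag 1 (\<lambda>_. e)) (0\<^sub>m 1 m) (0\<^sub>m m 1) B" (is "_ = ?F")
    proof (rule eq_matI)
      fix i j assume "i < dim_row ?F" "j < dim_col ?F"
      hence "i < Suc m" "j < Suc m" using B by (auto simp: mat_diag_def)
      thus "A' $$ (i, j) = ?F $$ (i, j)"
        using B by (cases i; cases j) (auto simp: A'0 A'0' mat_diag_def B_def)
    qed (use A' B in \<open>auto simp: mat_diag_def\<close>)
    have aV: "adj V \<in> carrier_mat m m" using V by simp
    have WW: "adj W * W = 1\<^sub>m (Suc m)"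
      unfolding aW unfolding W_def using V aV
      by (subst mult_four_block_diag[OF one_carrier_mat aV one_carrier_mat V(1)]) (auto simp: four_block_one_mat)
    have WAW: "adj W * A' * W = mat_diag (Suc m) (case_nat e d)"
      unfolding aW A'_block mat_diag_Suc unfolding W_def
      unfolding mult_four_block_diag[OF one_carrier_mat aV mat_diag_dim B] left_mult_one_mat[OF mat_diag_dim]
        mult_four_block_diag[OF mat_diag_dim mult_carrier_mat[OF aV B] one_carrier_mat V(1)]
        right_mult_one_mat[OF mat_diag_dim] V(3) ..
    note aWc = adj_carrier[OF W]
    have UW: "U * W \<in> carrier_mat (Suc m) (Suc m)" using U W by simp
    have aUW: "adj (U * W) = adj W * adj U" by (rule adj_mult[OF U(1) W])
    have "adj (U * W) * (U * W) = adj W * ((adj U * U) * W)"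
      unfolding aUW using assoc_mult_mat[OF aWc aU UW] assoc_mult_mat[OF aU U(1) W] by simp
    also have "\<dots> = 1\<^sub>m (Suc m)" using U(2) W WW by simp
    finally have 1: "adj (U * W) * (U * W) = 1\<^sub>m (Suc m)" .
    have "adj (U * W) * A * (U * W) = adj W * A' * W"
      unfolding aUW A'_def
      using A aU aWc U(1) W
      by (simp add: assoc_mult_mat[of _ "Suc m" "Suc m" _ "Suc m" _ "Suc m"]
          mult_carrier_mat[of _ "Suc m" "Suc m" _ "Suc m"])
    with 1 UW WAW show ?case by (intro exI[of _ "U * W"] exI[of _ "case_nat e d"]) simp
  qed
  thus ?thesis using that by blast
qed

section \<open>The bound for unit columns\<close>

text \<open>A diagonal Gram matrix means orthogonal columns with squared lengths \<open>f i\<close>,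
  so this is Pythagoras.\<close>

lemma vec_l2_mult_diagonal_gram:
  assumes M: "M \<in> carrier_mat m N" and gram: "adj M * M = mat_diag N (\<lambda>i. complex_of_real (f i))"
    and y: "y \<in> carrier_vec N"
  shows "(vec_l2 (M *\<^sub>v y))\<^sup>2 = (\<Sum>i<N. f i * (cmod (y $ i))\<^sup>2)"
proof -
  have "complex_of_real ((vec_l2 (M *\<^sub>v y))\<^sup>2) = y \<bullet>c (mat_diag N (\<lambda>i. complex_of_real (f i)) *\<^sub>v y)"
    unfolding vec_l2_mult_sq[OF M y] gram ..
  also have "mat_diag N (\<lambda>i. complex_of_real (f i)) *\<^sub>v y = vec N (\<lambda>i. complex_of_real (f i) * y $ i)"
  proof (rule eq_vecI)
    fix i assume "i < dim_vec (vec N (\<lambda>i. complex_of_real (f i) * y $ i))"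
    hence i: "i < N" by simp
    have "(mat_diag N (\<lambda>i. complex_of_real (f i)) *\<^sub>v y) $ i =
        (\<Sum>j = 0..<N. (if i = j then complex_of_real (f j) else 0) * y $ j)"
      using i y by (simp add: mat_diag_def scalar_prod_def)
    also have "\<dots> = (\<Sum>j = 0..<N. if i = j then complex_of_real (f j) * y $ j else 0)"
      by (rule sum.cong) auto
    finally show "(mat_diag N (\<lambda>i. complex_of_real (f i)) *\<^sub>v y) $ i = vec N (\<lambda>i. complex_of_real (f i) * y $ i) $ i"
      using i by simp
  qed (simp add: mat_diag_def)
  also have "y \<bullet>c vec N (\<lambda>i. complex_of_real (f i) * y $ i) = (\<Sum>i<N. complex_of_real (f i) * (y $ i * cnj (y $ i)))"
    by (simp add: scalar_prod_def lessThan_atLeast0 mult.left_commute)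
  also have "\<dots> = complex_of_real (\<Sum>i<N. f i * (cmod (y $ i))\<^sup>2)"
    by (simp add: complex_norm_square del: of_real_power)
  finally show ?thesis by (simp only: of_real_eq_iff)
qed

lemma vec_l2_mult_diagonal_gram_le:
  assumes M: "M \<in> carrier_mat m N" and gram: "adj M * M = mat_diag N (\<lambda>i. complex_of_real (f i))"
    and y: "y \<in> carrier_vec N" and le: "\<And>i. i < N \<Longrightarrow> f i \<le> \<mu>"
  shows "(vec_l2 (M *\<^sub>v y))\<^sup>2 \<le> \<mu> * (vec_l2 y)\<^sup>2"
  unfolding vec_l2_mult_diagonal_gram[OF M gram y] vec_l2_sq[of y] sum_distrib_left
  using y le by (auto intro!: sum_mono mult_right_mono)

text \<open>A zero column would put a unit vector into the kernel.\<close>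

lemma vec_l2_col_pos:
  assumes A: "A \<in> carrier_mat n n" and det: "det A \<noteq> 0" and i: "i < n"
  shows "vec_l2 (col A i) > 0"
proof (rule ccontr)
  assume "\<not> ?thesis"
  hence "(vec_l2 (col A i))\<^sup>2 = 0" using vec_l2_nonneg[of "col A i"] by simp
  hence z: "A $$ (l, i) = 0" if "l < n" for l
    using that A i by (auto simp: vec_l2_sq sum_nonneg_eq_0_iff)
  have "A *\<^sub>v unit_vec n i = 0\<^sub>v n"
    by (rule eq_vecI) (use A i z in auto)
  moreover have "unit_vec n i \<noteq> (0\<^sub>v n :: complex vec)" using i by simp
  ultimately have "det A = 0"
    using det_0_iff_vec_prod_zero_field[OF A] unit_vec_carrier by blast
  thus False using det by simp
qed

text \<open>Both sides are the squared Frobenius norm. The form \<open>M * adj M\<close> is chosen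
  because it does not change when \<open>M\<close> is multiplied on the right by a unitary
  matrix.\<close>

lemma sum_vec_l2_col_sq:
  assumes M: "M \<in> carrier_mat n n"
  shows "complex_of_real (\<Sum>i<n. (vec_l2 (col M i))\<^sup>2) = (\<Sum>l<n. (M * adj M) $$ (l, l))"
proof -
  have "complex_of_real (\<Sum>i<n. (vec_l2 (col M i))\<^sup>2) = (\<Sum>i<n. \<Sum>l<n. M $$ (l, i) * cnj (M $$ (l, i)))"
    using M by (simp add: vec_l2_sq complex_norm_square del: of_real_power)
  also have "\<dots> = (\<Sum>l<n. \<Sum>i<n. M $$ (l, i) * cnj (M $$ (l, i)))" by (rule sum.swap)
  also have "\<dots> = (\<Sum>l<n. (M * adj M) $$ (l, l))"
    using M by (simp add: scalar_prod_def lessThan_atLeast0)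
  finally show ?thesis .
qed

text \<open>The numbers \<open>d i\<close> are the eigenvalues of \<open>adj B * B\<close>. Their
  sum is the trace, and a nonsingular \<open>B\<close> makes \<open>B * U\<close> nonsingular, hence
  without zero columns.\<close>

lemma gram_diagonalization:
  assumes B: "B \<in> carrier_mat n n"
  obtains U d where "U \<in> carrier_mat n n" "adj U * U = 1\<^sub>m n"
    "adj (B * U) * (B * U) = mat_diag n (\<lambda>i. complex_of_real (d i))"
    "\<And>i. (0::real) \<le> d i" "(\<Sum>i<n. d i) = (\<Sum>i<n. (vec_l2 (col B i))\<^sup>2)"
    "\<And>i. det B \<noteq> 0 \<Longrightarrow> i < n \<Longrightarrow> 0 < d i"
proof -
  note aB = adj_carrier[OF B]
  have h: "adj (adj B * B) = adj B * B" using adj_mult[OF aB B] by simp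
  obtain U e where U: "U \<in> carrier_mat n n" "adj U * U = 1\<^sub>m n"
    and e: "adj U * (adj B * B) * U = mat_diag n e"
    using hermitian_unitarily_diagonalizable[OF mult_carrier_mat[OF aB B] h] by metis
  note aU = adj_carrier[OF U(1)]
  define W where "W = B * U"
  have W: "W \<in> carrier_mat n n" using B U by (simp add: W_def)
  have aW: "adj W = adj U * adj B" unfolding W_def by (rule adj_mult[OF B U(1)])
  have WW: "adj W * W = mat_diag n e"
    unfolding e[symmetric] aW unfolding W_def using B U(1) aU aB
    by (simp add: assoc_mult_mat[of _ n n _ n _ n] mult_carrier_mat[of _ n n _ n])
  \<comment> \<open>The spectral theorem yields complex diagonal entries; as squared column norms of
    \<open>W\<close> they are visibly real and nonnegative.\<close>
  define d where "d i = (vec_l2 (col W i))\<^sup>2" for i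
  have "mat_diag n e = mat_diag n (\<lambda>i. complex_of_real (d i))"
  proof (rule eq_matI)
    fix i j assume "i < dim_row (mat_diag n (\<lambda>i. complex_of_real (d i)))"
      "j < dim_col (mat_diag n (\<lambda>i. complex_of_real (d i)))"
    hence ij: "i < n" "j < n" by (auto simp: mat_diag_def)
    have "e i = (adj W * W) $$ (i, i)" unfolding WW using ij by (simp add: mat_diag_def)
    also have "\<dots> = complex_of_real (d i)"
      unfolding d_def vec_l2_sq using W ij
      by (simp add: scalar_prod_def lessThan_atLeast0 complex_norm_square mult.commute del: of_real_power)
    finally show "mat_diag n e $$ (i, j) = mat_diag n (\<lambda>i. complex_of_real (d i)) $$ (i, j)"
      using ij by (auto simp: mat_diag_def)
  qed (auto simp: mat_diag_def)
  hence 1: "adj (B * U) * (B * U) = mat_diag n (\<lambda>i. complex_of_real (d i))"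
    using WW by (simp add: W_def)
  have UU: "U * adj U = 1\<^sub>m n" by (rule mat_mult_left_right_inverse[OF aU U])
  have "W * adj W = B * ((U * adj U) * adj B)"
    unfolding aW unfolding W_def using B U(1) aU aB by (simp add: assoc_mult_mat[of _ n n _ n _ n] mult_carrier_mat[of _ n n _ n])
  hence "W * adj W = B * adj B" by (simp only: UU left_mult_one_mat[OF aB])
  hence "complex_of_real (\<Sum>i<n. d i) = complex_of_real (\<Sum>i<n. (vec_l2 (col B i))\<^sup>2)"
    unfolding d_def sum_vec_l2_col_sq[OF W] sum_vec_l2_col_sq[OF B] by simp
  hence 2: "(\<Sum>i<n. d i) = (\<Sum>i<n. (vec_l2 (col B i))\<^sup>2)" by (simp only: of_real_eq_iff)
  have 3: "0 < d i" if "det B \<noteq> 0" "i < n" for i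
  proof -
    have "det U \<noteq> 0" using arg_cong[OF U(2), of det] det_mult[OF aU U(1)] by auto
    hence "det W \<noteq> 0" using that det_mult[OF B U(1)] by (simp add: W_def)
    thus ?thesis using vec_l2_col_pos[OF W _ that(2)] by (simp add: d_def)
  qed
  show ?thesis by (rule that[OF U 1 _ 2 3]) (auto simp: d_def)
qed

text \<open>The compound of a unitary matrix is unitary, so \<open>x\<close> may be rotated until
  the Gram matrix of the compound is diagonal with the products of \<open>d\<close> as entries.
  Leaving \<open>\<mu>\<close> free serves the sharp and the strict bound alike.\<close>

lemma vec_l2_compound_le:
  assumes B: "B \<in> carrier_mat n n" and U: "U \<in> carrier_mat n n" "adj U * U = 1\<^sub>m n"
    and gram: "adj (B * U) * (B * U) = mat_diag n (\<lambda>i. complex_of_real (d i))"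
    and le: "\<And>S. S \<subseteq> {0..<n} \<Longrightarrow> card S = k \<Longrightarrow> prod d S \<le> \<mu>"
    and x: "x \<in> carrier_vec (length (ksubsets n k))"
  shows "(vec_l2 (compound k B *\<^sub>v x))\<^sup>2 \<le> \<mu> * (vec_l2 x)\<^sup>2"
proof -
  let ?N = "length (ksubsets n k)"
  define V where "V = compound k U"
  note aU = adj_carrier[OF U(1)]
  have BU: "B * U \<in> carrier_mat n n" using B U by simp
  have V: "V \<in> carrier_mat ?N ?N" using U by (simp add: V_def)
  have aV: "adj V \<in> carrier_mat ?N ?N" using V by simp
  have X: "compound k B \<in> carrier_mat ?N ?N" using B by simp
  have VV: "adj V * V = 1\<^sub>m ?N"
    unfolding V_def compound_adj[OF U(1), symmetric] compound_mult[OF aU U(1), symmetric] U(2)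
    by (rule compound_one)
  have VV': "V * adj V = 1\<^sub>m ?N" by (rule mat_mult_left_right_inverse[OF aV V VV])
  define y where "y = adj V *\<^sub>v x"
  have y: "y \<in> carrier_vec ?N" using aV x by (simp add: y_def)
  have "V *\<^sub>v y = x" unfolding y_def using assoc_mult_mat_vec[OF V aV x] VV' x by simp
  hence Bx: "compound k B *\<^sub>v x = compound k (B * U) *\<^sub>v y"
    unfolding compound_mult[OF B U(1)] V_def[symmetric] assoc_mult_mat_vec[OF X V y] by simp
  have ny: "vec_l2 y = vec_l2 x"
    unfolding y_def by (rule vec_l2_isometry[OF aV x]) (simp add: VV')
  have "adj (compound k (B * U)) * compound k (B * U) =
      mat_diag ?N (\<lambda>i. complex_of_real (prod d (set (ksubsets n k ! i))))"
    unfolding compound_adj[OF BU, symmetric] compound_mult[OF adj_carrier[OF BU] BU, symmetric] gram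
      compound_mat_diag by simp
  thus ?thesis
    unfolding Bx ny[symmetric]
  proof (rule vec_l2_mult_diagonal_gram_le[OF compound_carrier[OF BU] _ y])
    fix i assume "i < ?N"
    note m = ksubsets_memD[OF nth_mem[OF this]]
    show "prod d (set (ksubsets n k ! i)) \<le> \<mu>" by (rule le) (use m in auto)
  qed
qed

text \<open>After normalising the mean to \<open>1\<close>, AM-GM is the product of the inequalities \<open>t \<le> exp (t - 1)\<close>.\<close>

lemma prod_le_mean_power:
  fixes d :: "'a \<Rightarrow> real"
  assumes fin: "finite S" and nn: "\<And>i. i \<in> S \<Longrightarrow> 0 \<le> d i"
  shows "prod d S \<le> (sum d S / card S) ^ card S"
\<comment> \<open>Normalising divides by the mean, so a zero mean and the empty set are treated
  apart.\<close>
proof (cases "sum d S = 0 \<or> S = {}")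
  case True
  show ?thesis
  proof (cases "S = {}")
    case False
    hence "\<forall>i\<in>S. d i = 0" using True fin nn by (simp add: sum_nonneg_eq_0_iff)
    thus ?thesis using False fin True by (auto simp: prod_zero)
  qed simp
next
  case False
  define m where "m = sum d S / card S"
  have c: "card S > 0" using False fin by auto
  have "0 \<le> sum d S" by (rule sum_nonneg) (rule nn)
  hence m: "m > 0" using False c by (simp add: m_def)
  have "(\<Prod>i\<in>S. d i / m) \<le> (\<Prod>i\<in>S. exp (d i / m - 1))"
  proof (intro prod_mono conjI)
    fix i assume "i \<in> S"
    thus "0 \<le> d i / m" using nn m by simp
    show "d i / m \<le> exp (d i / m - 1)" using exp_ge_add_one_self[of "d i / m - 1"] by simp
  qed
  also have "\<dots> = exp (sum d S / m - card S)"
    by (simp add: exp_sum[OF fin, symmetric] sum_subtractf sum_divide_distrib)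
  also have "sum d S / m = card S" using c False by (simp add: m_def)
  finally have "(\<Prod>i\<in>S. d i / m) \<le> 1" by simp
  hence "prod d S \<le> m ^ card S" using m by (simp add: prod_dividef divide_le_eq)
  thus ?thesis by (simp add: m_def)
qed

text \<open>Guarantees that the compound has a unit vector to act on, so the supremum in
  \<open>spec_norm\<close> ranges over a nonempty set.\<close>

lemma ksubsets_nonempty:
  assumes "k \<le> n"
  shows "0 < length (ksubsets n k)"
proof -
  have "sorted_list_of_set {0..<k} \<in> set (ksubsets n k)"
    by (rule sorted_list_of_set_ksubsets) (use assms in auto)
  thus ?thesis by (cases "ksubsets n k") auto
qed

text \<open>AM-GM is applied to each \<open>k\<close>-subset of eigenvalues; as all are nonnegative,
  the partial sum is at most the trace \<open>n\<close>.\<close>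

lemma vec_l2_compound_unit_columns:
  assumes B: "B \<in> carrier_mat n n" and unit: "\<And>i. i < n \<Longrightarrow> vec_l2 (col B i) = 1"
    and x: "x \<in> carrier_vec (length (ksubsets n k))"
  shows "(vec_l2 (compound k B *\<^sub>v x))\<^sup>2 \<le> (real n / real k) ^ k * (vec_l2 x)\<^sup>2"
proof -
  obtain U d where U: "U \<in> carrier_mat n n" "adj U * U = 1\<^sub>m n"
    and gram: "adj (B * U) * (B * U) = mat_diag n (\<lambda>i. complex_of_real (d i))"
    and nn: "\<And>i. (0::real) \<le> d i" and s: "(\<Sum>i<n. d i) = (\<Sum>i<n. (vec_l2 (col B i))\<^sup>2)"
    using gram_diagonalization[OF B] by metis
  have s: "(\<Sum>i<n. d i) = n" using s unit by simp
  show ?thesis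
  proof (rule vec_l2_compound_le[OF B U gram _ x])
    fix S assume S: "S \<subseteq> {0..<n}" "card S = k"
    have le: "sum d S \<le> n"
      unfolding s[symmetric] by (rule sum_mono2) (use S nn in auto)
    have "prod d S \<le> (sum d S / k) ^ k"
      using prod_le_mean_power[of S d] nn S finite_subset[OF S(1)] by simp
    also have "(sum d S / k) ^ k \<le> (real n / k) ^ k"
      using le by (intro power_mono divide_right_mono) (auto simp: sum_nonneg nn)
    finally show "prod d S \<le> (real n / k) ^ k" .
  qed
qed

text \<open>For nonsingular \<open>B\<close> every eigenvalue of \<open>B\<^sup>*B\<close> is positive, so fewer than \<open>n\<close> of them
  have sum strictly below the trace.\<close>

lemma vec_l2_compound_unit_columns_strict:
  assumes B: "B \<in> carrier_mat n n" and unit: "\<And>i. i < n \<Longrightarrow> vec_l2 (col B i) = 1"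
    and det: "det B \<noteq> 0" and k: "1 \<le> k" "k < n"
  obtains \<mu> where "0 \<le> \<mu>" "\<mu> < (real n / real k) ^ k"
    "\<And>x. x \<in> carrier_vec (length (ksubsets n k)) \<Longrightarrow> (vec_l2 (compound k B *\<^sub>v x))\<^sup>2 \<le> \<mu> * (vec_l2 x)\<^sup>2"
proof -
  obtain U d where U: "U \<in> carrier_mat n n" "adj U * U = 1\<^sub>m n"
    and gram: "adj (B * U) * (B * U) = mat_diag n (\<lambda>i. complex_of_real (d i))"
    and nn: "\<And>i. (0::real) \<le> d i" and s: "(\<Sum>i<n. d i) = (\<Sum>i<n. (vec_l2 (col B i))\<^sup>2)"
    and pos: "\<And>i. det B \<noteq> 0 \<Longrightarrow> i < n \<Longrightarrow> 0 < d i"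
    using gram_diagonalization[OF B] by metis
  have s: "(\<Sum>i<n. d i) = n" using s unit by simp
  let ?S = "{S. S \<subseteq> {0..<n} \<and> card S = k}"
  \<comment> \<open>A strict bound for each vector could be lost in the supremum; the maximum over
    finitely many subsets gives one constant for all vectors.\<close>
  define \<mu> where "\<mu> = Max (prod d ` ?S)"
  have "finite ?S" by (rule finite_subset[of _ "Pow {0..<n}"]) auto
  hence fin: "finite (prod d ` ?S)" by simp
  have "{0..<k} \<in> ?S" using k by auto
  hence ne: "prod d ` ?S \<noteq> {}" by blast
  obtain T where T: "T \<subseteq> {0..<n}" "card T = k" "\<mu> = prod d T"
    using Max_in[OF fin ne] unfolding \<mu>_def by auto
  \<comment> \<open>Here \<open>k < n\<close> enters: the maximising set omits some index
    \<open>j\<close>, whose eigenvalue is positive.\<close>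
  have "\<not> {0..<n} \<subseteq> T" using T k card_mono[of T "{0..<n}"] finite_subset[OF T(1)] by auto
  then obtain j where j: "j \<in> {0..<n}" "j \<notin> T" by blast
  have less: "sum d T < n"
    unfolding s[symmetric] by (rule sum_strict_mono2[of _ _ j]) (use T j nn pos[OF det] in auto)
  have "prod d T \<le> (sum d T / k) ^ k"
    using prod_le_mean_power[of T d] nn T finite_subset[OF T(1)] by simp
  also have "(sum d T / k) ^ k < (real n / k) ^ k"
    using k less by (intro power_strict_mono divide_strict_right_mono) (auto simp: sum_nonneg nn)
  finally have lt: "\<mu> < (real n / k) ^ k" using T by simp
  show ?thesis
  proof (rule that[OF _ lt])
    show "0 \<le> \<mu>" using T nn by (simp add: prod_nonneg)
    fix x :: "complex vec" assume x: "x \<in> carrier_vec (length (ksubsets n k))"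
    show "(vec_l2 (compound k B *\<^sub>v x))\<^sup>2 \<le> \<mu> * (vec_l2 x)\<^sup>2"
      by (rule vec_l2_compound_le[OF B U gram _ x]) (auto simp: \<mu>_def intro!: Max_ge[OF fin])
  qed
qed

section \<open>The operator norm as a supremum over unit vectors\<close>

lemma vec_l2_unit_vec: "i < N \<Longrightarrow> vec_l2 (unit_vec N i) = 1"
proof -
  assume i: "i < N"
  have "(vec_l2 (unit_vec N i))\<^sup>2 = (\<Sum>j<N. if j = i then 1 else 0)"
    unfolding vec_l2_sq by (rule sum.cong) (use i in auto)
  hence "(vec_l2 (unit_vec N i))\<^sup>2 = 1\<^sup>2" using i by simp
  thus ?thesis by (rule power2_eq_imp_eq) auto
qed

lemma vec_l2_smult: "vec_l2 (c \<cdot>\<^sub>v v) = cmod c * vec_l2 v"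
proof -
  have "(vec_l2 (c \<cdot>\<^sub>v v))\<^sup>2 = (cmod c * vec_l2 v)\<^sup>2"
    by (simp add: vec_l2_sq power_mult_distrib norm_mult sum_distrib_left)
  thus ?thesis by (rule power2_eq_imp_eq) auto
qed

lemma spec_norm_le:
  assumes "M \<in> carrier_mat m N" "0 < N"
    and "\<And>x. x \<in> carrier_vec N \<Longrightarrow> vec_l2 x = 1 \<Longrightarrow> vec_l2 (M *\<^sub>v x) \<le> c"
  shows "spec_norm M \<le> c"
  unfolding spec_norm_def
proof (rule cSup_least)
  have "vec_l2 (M *\<^sub>v unit_vec N 0) \<in> {vec_l2 (M *\<^sub>v x) |x. x \<in> carrier_vec (dim_col M) \<and> vec_l2 x = 1}"
    using assms vec_l2_unit_vec[of 0 N] by auto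
  thus "{vec_l2 (M *\<^sub>v x) |x. x \<in> carrier_vec (dim_col M) \<and> vec_l2 x = 1} \<noteq> {}" by blast
qed (use assms in auto)

text \<open>The bound \<open>c\<close> makes the set bounded above, as \<open>cSup_upper\<close>
  requires; any finite value will do.\<close>

lemma spec_norm_ge:
  assumes "M \<in> carrier_mat m N" "x \<in> carrier_vec N" "vec_l2 x = 1"
    and "\<And>x. x \<in> carrier_vec N \<Longrightarrow> vec_l2 x = 1 \<Longrightarrow> vec_l2 (M *\<^sub>v x) \<le> c"
  shows "vec_l2 (M *\<^sub>v x) \<le> spec_norm M"
  unfolding spec_norm_def
  by (rule cSup_upper) (use assms in \<open>auto intro!: bdd_aboveI[of _ c]\<close>)

section \<open>The extremal matrix and the nonsingular case\<close>

lemma sum_power_root_unity: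
  fixes w :: "'a :: field"
  assumes "w ^ n = 1"
  shows "(\<Sum>l<n. w ^ l) = (if w = 1 then of_nat n else 0)"
  using assms geometric_sum[of w n] by simp

text \<open>The first \<open>k\<close> rows of the discrete Fourier matrix, scaled to unit columns, form a tight frame.\<close>

lemma tight_frame_exists:
  assumes "1 \<le> k" "k \<le> n"
  obtains B where "B \<in> carrier_mat n n" "\<And>i. i < n \<Longrightarrow> vec_l2 (col B i) = 1"
    "B * adj B = mat_diag n (\<lambda>i. if i < k then complex_of_real (real n / real k) else 0)"
proof -
  \<comment> \<open>For \<open>a < n\<close> these are the distinct \<open>n\<close>th roots of
    unity.\<close>
  define z where "z a = cis (2 * pi * real a / real n)" for a
  \<comment> \<open>Each column has \<open>k\<close> entries of modulus \<open>1 / sqrt k\<close>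
    and zeros below, hence length one.\<close>
  define B where "B = mat n n (\<lambda>(i, j). if i < k then z i ^ j / complex_of_real (sqrt k) else 0)"
  have B: "B \<in> carrier_mat n n" by (simp add: B_def)
  have n: "n > 0" and k: "k > 0" using assms by auto
  have z: "z a \<noteq> 0" "z a ^ n = 1" "cnj (z a) = inverse (z a)" "cmod (z a) = 1" for a
    using n by (auto simp: z_def DeMoivre cis_cnj cis_inverse)
  have inj: "a = b" if "z a = z b" "a < n" "b < n" for a b
    using bij_betw_roots_unity[OF n] that unfolding bij_betw_def inj_on_def z_def by blast
  have "vec_l2 (col B j) = 1" if j: "j < n" for j
  proof -
    have "(vec_l2 (col B j))\<^sup>2 = (\<Sum>i<n. if i < k then 1 / real k else 0)"
      unfolding vec_l2_sq using B j
      by (auto simp: B_def norm_divide norm_power z power_divide intro!: sum.cong)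
    also have "\<dots> = (\<Sum>i<k. 1 / real k)"
      by (rule sum.mono_neutral_cong_right) (use assms in auto)
    also have "\<dots> = 1\<^sup>2" using k by simp
    finally show ?thesis by (rule power2_eq_imp_eq) auto
  qed
  moreover have "B * adj B = mat_diag n (\<lambda>i. if i < k then complex_of_real (real n / real k) else 0)" (is "_ = ?D")
  proof (rule eq_matI)
    fix a b assume "a < dim_row ?D" "b < dim_col ?D"
    hence ab: "a < n" "b < n" by (auto simp: mat_diag_def)
    have "(B * adj B) $$ (a, b) = (\<Sum>l<n. B $$ (a, l) * cnj (B $$ (b, l)))"
      using B ab by (simp add: scalar_prod_def lessThan_atLeast0)
    also have "\<dots> = ?D $$ (a, b)"
    proof (cases "a < k \<and> b < k")
      case True
      have kk: "complex_of_real (sqrt k) * complex_of_real (sqrt k) = of_nat k"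
        by (simp flip: of_real_mult)
      \<comment> \<open>Conjugation inverts a root of unity, so the product of two rows is a power
        sum of the root \<open>z a / z b\<close>, which vanishes unless
        \<open>a = b\<close>.\<close>
      have "(\<Sum>l<n. B $$ (a, l) * cnj (B $$ (b, l))) = (\<Sum>l<n. (z a / z b) ^ l / of_nat k)"
        by (rule sum.cong) (use True ab z in \<open>auto simp: B_def kk divide_inverse power_mult_distrib power_inverse simp flip: kk\<close>)
      also have "\<dots> = (if z a / z b = 1 then of_nat n else 0) / of_nat k"
        unfolding sum_divide_distrib[symmetric] by (subst sum_power_root_unity) (auto simp: power_divide z)
      also have "\<dots> = ?D $$ (a, b)"
        using ab True z(1)[of b] inj[of a b] by (auto simp: mat_diag_def)
      finally show ?thesis .
    next
      case False
      hence "(\<Sum>l<n. B $$ (a, l) * cnj (B $$ (b, l))) = 0"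
        using ab by (intro sum.neutral) (auto simp: B_def)
      thus ?thesis using ab False by (auto simp: mat_diag_def)
    qed
    finally show "(B * adj B) $$ (a, b) = ?D $$ (a, b)" .
  qed (use B in \<open>auto simp: mat_diag_def\<close>)
  ultimately show ?thesis using that B by blast
qed

lemma powr_half_power:
  fixes x :: real
  assumes "x > 0"
  shows "x powr (real k / 2) = sqrt (x ^ k)"
  using assms by (simp add: powr_half_sqrt[symmetric] powr_powr powr_realpow[symmetric])

lemma vec_l2_compound_le_sqrt:
  assumes B: "B \<in> carrier_mat n n" and unit: "\<And>i. i < n \<Longrightarrow> vec_l2 (col B i) = 1"
    and x: "x \<in> carrier_vec (length (ksubsets n k))" "vec_l2 x = 1"
  shows "vec_l2 (compound k B *\<^sub>v x) \<le> sqrt ((real n / real k) ^ k)"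
  using vec_l2_compound_unit_columns[OF B unit x(1)] x(2) by (simp add: real_le_rsqrt)

text \<open>By \<open>frame\<close>, \<open>B * adj B\<close> is \<open>n/k\<close> times a
  coordinate projection of rank \<open>k\<close>. Its compound has the eigenvalue
  \<open>(n/k)^k\<close> at the subset \<open>{0..<k}\<close>, and pulling that coordinate vector
  back by the adjoint gives a vector attaining the bound.\<close>

lemma spec_norm_compound_tight_frame:
  assumes k: "1 \<le> k" "k \<le> n" and B: "B \<in> carrier_mat n n"
    and unit: "\<And>i. i < n \<Longrightarrow> vec_l2 (col B i) = 1"
    and frame: "B * adj B = mat_diag n (\<lambda>i. if i < k then complex_of_real (real n / real k) else 0)"
  shows "spec_norm (compound k B) = sqrt ((real n / real k) ^ k)"
proof (rule antisym)
  let ?N = "length (ksubsets n k)"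
  define m where "m = (real n / real k) ^ k"
  have m: "m > 0" using k by (simp add: m_def)
  note c = compound_carrier[OF B, of k]
  note ac = adj_carrier[OF c]
  show "spec_norm (compound k B) \<le> sqrt ((real n / real k) ^ k)"
    by (rule spec_norm_le[OF c ksubsets_nonempty[OF k(2)] vec_l2_compound_le_sqrt[OF B unit]])
  have "sorted_list_of_set {0..<k} \<in> set (ksubsets n k)"
    by (rule sorted_list_of_set_ksubsets) (use k in auto)
  then obtain i where i: "i < ?N" "ksubsets n k ! i = sorted_list_of_set {0..<k}"
    by (metis in_set_conv_nth)
  let ?e = "unit_vec ?N i :: complex vec"
  have "compound k B * adj (compound k B) =
      mat_diag ?N (\<lambda>j. \<Prod>a\<in>set (ksubsets n k ! j). if a < k then complex_of_real (real n / real k) else 0)"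
    unfolding compound_adj[OF B, symmetric] compound_mult[OF B adj_carrier[OF B], symmetric] frame
    by (rule compound_mat_diag)
  moreover have "mat_diag ?N g *\<^sub>v ?e = g i \<cdot>\<^sub>v ?e" for g :: "nat \<Rightarrow> complex"
    by (rule eq_vecI) (use i in \<open>auto simp: mat_diag_def\<close>)
  ultimately have XX: "(compound k B * adj (compound k B)) *\<^sub>v ?e = complex_of_real m \<cdot>\<^sub>v ?e"
    by (simp add: i m_def)
  define y where "y = adj (compound k B) *\<^sub>v ?e"
  have y: "y \<in> carrier_vec ?N" using mult_mat_vec_carrier[OF ac unit_vec_carrier] by (simp add: y_def)
  have Xy: "compound k B *\<^sub>v y = complex_of_real m \<cdot>\<^sub>v ?e"
    unfolding y_def XX[symmetric] by (rule assoc_mult_mat_vec[OF c ac unit_vec_carrier, symmetric])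
  \<comment> \<open>The squared length of \<open>y\<close> is the inner product of \<open>?e\<close>
    with its image under the compound times its adjoint, namely \<open>m\<close>.\<close>
  have "complex_of_real ((vec_l2 y)\<^sup>2) = ?e \<bullet>c (complex_of_real m \<cdot>\<^sub>v ?e)"
    unfolding y_def vec_l2_mult_sq[OF ac unit_vec_carrier] by (simp add: XX)
  also have "\<dots> = complex_of_real m" using i by (simp add: scalar_prod_left_unit)
  finally have ny: "vec_l2 y = sqrt m"
    by (metis of_real_eq_iff real_sqrt_unique vec_l2_nonneg)
  \<comment> \<open>Normalising \<open>y\<close> leaves an image of length
    \<open>m / sqrt m\<close>, which is the upper bound.\<close>
  define x where "x = complex_of_real (1 / sqrt m) \<cdot>\<^sub>v y"
  have x: "x \<in> carrier_vec ?N" using y by (simp add: x_def)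
  have nx: "vec_l2 x = 1" unfolding x_def vec_l2_smult ny using m by (simp add: norm_divide)
  have "vec_l2 (compound k B *\<^sub>v x) = m / sqrt m"
    unfolding x_def mult_mat_vec[OF c y] vec_l2_smult Xy vec_l2_unit_vec[OF i(1)]
    using m by (simp add: norm_divide)
  also have "\<dots> = sqrt m" using m by (simp add: real_div_sqrt)
  finally have "sqrt m = vec_l2 (compound k B *\<^sub>v x)" by (rule sym)
  also have "\<dots> \<le> spec_norm (compound k B)"
    by (rule spec_norm_ge[OF c x nx]) (rule vec_l2_compound_le_sqrt[OF B unit])
  finally show "sqrt ((real n / real k) ^ k) \<le> spec_norm (compound k B)"
    unfolding m_def .
qed

text \<open>Writing \<open>A = B * D\<close>, the compound of \<open>D\<close> is diagonal with
  products of column norms as entries and stretches by at most the maximal product; the strict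
  factor comes from the compound of \<open>B\<close>.\<close>

lemma spec_norm_compound_nonsingular:
  assumes A: "A \<in> carrier_mat n n" and det: "det A \<noteq> 0" and k: "1 \<le> k" "k < n"
  shows "spec_norm (compound k A) < sqrt ((real n / real k) ^ k) *
    Max {\<Prod>i\<in>\<alpha>. vec_l2 (col A i) | \<alpha>. \<alpha> \<subseteq> {0..<n} \<and> card \<alpha> = k}"
proof -
  let ?N = "length (ksubsets n k)"
  define c where "c i = vec_l2 (col A i)" for i
  have c: "c i > 0" if "i < n" for i using vec_l2_col_pos[OF A det that] by (simp add: c_def)
  define P where "P = {\<Prod>i\<in>\<alpha>. c i | \<alpha>. \<alpha> \<subseteq> {0..<n} \<and> card \<alpha> = k}"
  have P: "P = prod c ` {\<alpha>. \<alpha> \<subseteq> {0..<n} \<and> card \<alpha> = k}" by (auto simp: P_def)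
  have "finite {\<alpha>. \<alpha> \<subseteq> {0..<n} \<and> card \<alpha> = k}"
    by (rule finite_subset[of _ "Pow {0..<n}"]) auto
  hence fin: "finite P" unfolding P by (rule finite_imageI)
  have "prod c {0..<k} \<in> P" unfolding P using k by auto
  moreover have "prod c {0..<k} > 0" using c k by (intro prod_pos) auto
  \<comment> \<open>Positivity keeps the inequality strict when the bound for \<open>B\<close> is
    multiplied by \<open>Max P\<close>.\<close>
  ultimately have pos: "Max P > 0" using Max_ge[OF fin] by (meson less_le_trans)
  \<comment> \<open>Dividing by the column norms is legitimate because a nonsingular matrix has no
    zero column.\<close>
  define B where "B = A * mat_diag n (\<lambda>i. complex_of_real (1 / c i))"
  define D where "D = mat_diag n (\<lambda>i. complex_of_real (c i))"
  have B: "B \<in> carrier_mat n n" using A by (simp add: B_def)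
  have D: "D \<in> carrier_mat n n" by (simp add: D_def)
  have B_ind: "B $$ (i, j) = A $$ (i, j) / c j" if "i < n" "j < n" for i j
    using that by (simp add: B_def mat_diag_mult_right[OF A])
  have ABD: "A = B * D"
    unfolding D_def mat_diag_mult_right[OF B]
    by (rule eq_matI) (use A c in \<open>auto simp: B_ind less_imp_neq[THEN not_sym]\<close>)
  have unit: "vec_l2 (col B j) = 1" if j: "j < n" for j
  proof -
    have "col B j = complex_of_real (1 / c j) \<cdot>\<^sub>v col A j"
      by (rule eq_vecI) (use A B j in \<open>auto simp: B_ind\<close>)
    thus ?thesis using c[OF j] by (simp add: vec_l2_smult norm_divide c_def)
  qed
  have detB: "det B \<noteq> 0" using det det_mult[OF B D] ABD by auto
  obtain \<mu> where \<mu>: "0 \<le> \<mu>" "\<mu> < (real n / real k) ^ k"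
    and le: "\<And>x. x \<in> carrier_vec ?N \<Longrightarrow> (vec_l2 (compound k B *\<^sub>v x))\<^sup>2 \<le> \<mu> * (vec_l2 x)\<^sup>2"
    using vec_l2_compound_unit_columns_strict[OF B unit detB k] by metis
  note cB = compound_carrier[OF B, of k] and cD = compound_carrier[OF D, of k]
  have gramD: "adj (compound k D) * compound k D =
      mat_diag ?N (\<lambda>i. complex_of_real ((prod c (set (ksubsets n k ! i)))\<^sup>2))"
    unfolding D_def compound_mat_diag adj_mat_diag mat_diag_diag
    by (simp add: power2_eq_square)
  have leD: "(vec_l2 (compound k D *\<^sub>v x))\<^sup>2 \<le> (Max P)\<^sup>2 * (vec_l2 x)\<^sup>2" if x: "x \<in> carrier_vec ?N" for x
  proof (rule vec_l2_mult_diagonal_gram_le[OF cD gramD x])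
    fix i assume "i < ?N"
    note m = ksubsets_memD[OF nth_mem[OF this]]
    have "prod c (set (ksubsets n k ! i)) \<in> P" unfolding P using m by auto
    thus "(prod c (set (ksubsets n k ! i)))\<^sup>2 \<le> (Max P)\<^sup>2"
      by (intro power_mono Max_ge[OF fin] prod_nonneg) (auto simp: c_def)
  qed
  have "spec_norm (compound k A) \<le> sqrt \<mu> * Max P"
  proof (rule spec_norm_le[OF compound_carrier[OF A] ksubsets_nonempty])
    fix x :: "complex vec" assume x: "x \<in> carrier_vec ?N" "vec_l2 x = 1"
    have Dx: "compound k D *\<^sub>v x \<in> carrier_vec ?N" by (rule mult_mat_vec_carrier[OF cD x(1)])
    have "(vec_l2 (compound k A *\<^sub>v x))\<^sup>2 = (vec_l2 (compound k B *\<^sub>v (compound k D *\<^sub>v x)))\<^sup>2"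
      unfolding ABD compound_mult[OF B D] assoc_mult_mat_vec[OF cB cD x(1)] ..
    also have "\<dots> \<le> \<mu> * (vec_l2 (compound k D *\<^sub>v x))\<^sup>2" by (rule le[OF Dx])
    also have "\<dots> \<le> \<mu> * (Max P)\<^sup>2" using leD[OF x(1)] x(2) \<mu>(1) by (intro mult_left_mono) auto
    also have "\<dots> = (sqrt \<mu> * Max P)\<^sup>2" using \<mu>(1) by (simp add: power_mult_distrib)
    finally show "vec_l2 (compound k A *\<^sub>v x) \<le> sqrt \<mu> * Max P"
      by (rule power2_le_imp_le) (use \<mu>(1) pos in auto)
  qed (use k in auto)
  also have "\<dots> < sqrt ((real n / real k) ^ k) * Max P"
    using \<mu>(2) pos by simp
  finally show ?thesis unfolding P_def c_def .
qed

text \<open>The maximum defining \<open>theta_k\<close> is expressed as an upper bound together with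
  a matrix attaining it.\<close>

theorem theorem2p6:
  fixes n k :: nat
  assumes "1 \<le> k" and "k \<le> n"
  shows "(\<forall>B \<in> carrier_mat n n. (\<forall>i<n. vec_l2 (col B i) = 1) \<longrightarrow>
            spec_norm (compound k B) \<le> (real n / real k) powr (real k / 2))
       \<and> (\<exists>B \<in> carrier_mat n n. (\<forall>i<n. vec_l2 (col B i) = 1) \<and>
            spec_norm (compound k B) = (real n / real k) powr (real k / 2))
       \<and> (\<forall>A \<in> carrier_mat n n. det A \<noteq> 0 \<longrightarrow> k < n \<longrightarrow>
            spec_norm (compound k A) < (real n / real k) powr (real k / 2) *
              Max {\<Prod>i\<in>\<alpha>. vec_l2 (col A i) | \<alpha>. \<alpha> \<subseteq> {0..<n} \<and> card \<alpha> = k})"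
proof -
  have powr: "(real n / real k) powr (real k / 2) = sqrt ((real n / real k) ^ k)"
    by (rule powr_half_power) (use assms in simp)
  obtain B where B: "B \<in> carrier_mat n n" "\<And>i. i < n \<Longrightarrow> vec_l2 (col B i) = 1"
    "B * adj B = mat_diag n (\<lambda>i. if i < k then complex_of_real (real n / real k) else 0)"
    using tight_frame_exists[OF assms] by metis
  show ?thesis
    unfolding powr
  proof (intro conjI ballI impI)
    fix B assume B: "B \<in> carrier_mat n n" "\<forall>i<n. vec_l2 (col B i) = 1"
    show "spec_norm (compound k B) \<le> sqrt ((real n / real k) ^ k)"
      using spec_norm_le[OF compound_carrier[OF B(1)] ksubsets_nonempty[OF assms(2)]
          vec_l2_compound_le_sqrt[OF B(1)]] B(2) by blast
  next
    show "\<exists>B\<in>carrier_mat n n. (\<forall>i<n. vec_l2 (col B i) = 1) \<and>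
        spec_norm (compound k B) = sqrt ((real n / real k) ^ k)"
      using B spec_norm_compound_tight_frame[OF assms B] by blast
  qed (rule spec_norm_compound_nonsingular[OF _ _ assms(1)])
qed

end
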